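(* A tree $T$ is perfect for the star-game with Maximizer responding (and Minimizer initiating) if and only if $T$ belongs to the family $\mathcal{D}$.
   Context: Graphs are finite, simple and undirected; a tree has at least one vertex. $P_3$ is the path on three vertices (also called a 2-star, its center being the degree-2 vertex); copies of $P_3$ in a graph are subgraphs, not necessarily induced. The star-game on a graph $G$ is played by two players, Maximizer and Minimizer; throughout the game one of them is the initiator and the other is the responder. In each round, the initiator chooses a vertex $v$ of the current graph such that the current graph contains at least one copy of $P_3$ with $v$ as its center vertex; the responder then chooses one copy of $P_3$ in the current graph with $v$ as its center; the three vertices of that copy are removed, and the next round is played on the subgraph induced by the remaining vertices. The game ends when the remaining graph contains no copy of $P_3$. Maximizer tries to maximize, and Minimizer tries to minimize, the number of copies of $P_3$ taken. The value of the game is the number of copies taken under optimal play by both players. A graph is perfect (for a given version of the game) if under optimal play all vertices are taken, i.e. the value of the game equals $|V(G)|/3$. $\mathcal{D}$ is the family of forests obtained as follows: take some number of disjoint 2-stars and then add edges between their centers without creating a cycle. *)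

theory Defs
  imports "Graph_Theory.Graph_Theory" "HOL-Library.Disjoint_Sets"
begin

text \<open>
  Finite simple undirected graphs are the library's \<open>pair_graph\<close>s: finite, symmetric and
  loop-free digraphs whose arcs are pairs of vertices, an edge being a pair of opposite arcs.
  The library's \<open>forest\<close> and \<open>tree\<close> cannot be used here, because they count
  a single undirected edge, traversed back and forth, as a cycle of length 2; a cycle of an
  undirected graph has length at least 3.
\<close>

definition undirected_forest :: "'a pair_pre_digraph \<Rightarrow> bool" where
  "undirected_forest G \<longleftrightarrow>
     pair_graph G \<and> \<not> (\<exists>p. pre_digraph.cycle (with_proj G) p \<and> length p \<ge> 3)"

text \<open>The library's \<open>connected\<close> includes that there is at least one vertex.\<close>

definition undirected_tree :: "'a pair_pre_digraph \<Rightarrow> bool" where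
  "undirected_tree G \<longleftrightarrow> undirected_forest G \<and> Digraph_Component.connected (with_proj G)"

definition induced_pair :: "'a pair_pre_digraph \<Rightarrow> 'a set \<Rightarrow> 'a pair_pre_digraph" where
  "induced_pair G U = \<lparr>pverts = U, parcs = {(x, y) \<in> parcs G. x \<in> U \<and> y \<in> U}\<rparr>"

lemma with_proj_induced_pair: "with_proj (induced_pair G U) = with_proj G \<restriction> U"
  by (auto simp: with_proj_def induced_pair_def induce_subgraph_def)

definition two_star :: "'a \<Rightarrow> 'a pair_pre_digraph \<Rightarrow> bool" where
  "two_star c H \<longleftrightarrow>
     (\<exists>a b. distinct [a, c, b] \<and>
        H = \<lparr>pverts = {a, c, b}, parcs = {(a, c), (c, a), (c, b), (b, c)}\<rparr>)"

definition P3_copies :: "'a pair_pre_digraph \<Rightarrow> 'a \<Rightarrow> 'a pair_pre_digraph set" where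
  "P3_copies G v = {H. two_star v H \<and> subgraph (with_proj H) (with_proj G)}"

definition P3_centers :: "'a pair_pre_digraph \<Rightarrow> 'a set" where
  "P3_centers G = {v. P3_copies G v \<noteq> {}}"

lemma P3_copiesD:
  assumes "H \<in> P3_copies G v"
  shows "pverts H \<subseteq> pverts G" "v \<in> pverts H"
  using assms by (auto simp: P3_copies_def two_star_def dest: subgraph_imp_subverts)

datatype player = Maximizer | Minimizer

fun opponent :: "player \<Rightarrow> player" where
  "opponent Maximizer = Minimizer"
| "opponent Minimizer = Maximizer"

fun best :: "player \<Rightarrow> nat set \<Rightarrow> nat" where
  "best Maximizer X = Max X"
| "best Minimizer X = Min X"

text \<open>
  The number of copies of \<open>P\<^sub>3\<close> taken under optimal play on \<open>G\<close>, by backward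
  induction, where the first argument is the initiator. The finiteness guard only serves
  termination; for infinite \<open>G\<close> the value 0 is meaningless.
\<close>

function star_game_value :: "player \<Rightarrow> 'a pair_pre_digraph \<Rightarrow> nat" where
  "star_game_value I G =
     (if finite (pverts G) \<and> P3_centers G \<noteq> {} then
        1 + best I ((\<lambda>v. best (opponent I)
              ((\<lambda>H. star_game_value I (induced_pair G (pverts G - pverts H))) ` P3_copies G v))
            ` P3_centers G)
      else 0)"
  by pat_completeness auto
termination
proof (relation "Wellfounded.measure (\<lambda>(I, G). card (pverts G))", goal_cases)
  case 1
  show ?case by simp
next
  case (2 I G v H)
  then have "pverts G - pverts H \<subset> pverts G"
    using P3_copiesD[of H G v] by blast
  with 2 show ?case
    by (auto simp: induced_pair_def intro: psubset_card_mono)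
qed

declare star_game_value.simps [simp del]

text \<open>Perfection for the version of the game in which the given player is the initiator.\<close>

definition star_perfect :: "player \<Rightarrow> 'a pair_pre_digraph \<Rightarrow> bool" where
  "star_perfect I G \<longleftrightarrow> real (star_game_value I G) = real (card (pverts G)) / 3"

text \<open>
  Forests obtained from disjoint 2-stars by adding edges between their centers without creating
  a cycle (the family \<open>\<D>\<close>): \<open>S\<close> is the set of the chosen 2-stars, each paired with its center,
  and \<open>F\<close> is the set of arcs of the added edges; that these come in opposite pairs
  and that no loop is added follows from the resulting graph being an undirected forest.
\<close>

definition star_forests :: "'a pair_pre_digraph set" where
  "star_forests =
     {G. undirected_forest G \<and>
         (\<exists>S F. finite S \<and> (\<forall>(c, H) \<in> S. two_star c H) \<and>
            disjoint_family_on (\<lambda>(c, H). pverts H) S \<and>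
            F \<subseteq> fst ` S \<times> fst ` S \<and>
            pverts G = (\<Union>(c, H) \<in> S. pverts H) \<and>
            parcs G = (\<Union>(c, H) \<in> S. parcs H) \<union> F)}"

end

theory Submission
  imports Defs
begin

text \<open>
  Since every round removes three vertices, the value is at most a third of the number of vertices,
  and equality holds exactly if Maximizer can always answer so that the remaining graph is perfect
  again (\<open>star_perfect_Minimizer_iff\<close>). So perfection means that Minimizer can never force the game
  to end with vertices left over.

  In a graph of \<open>\<D>\<close>, the vertices of degree at least 2 are precisely the centers of the stars.
  Maximizer answers the choice of a center by taking its own star, and the rest is again in \<open>\<D>\<close>
  (\<open>star_centers_imp_perfect\<close>).

  Conversely, let a nonempty forest be perfect. Then it has a vertex of degree at least 2, as
  otherwise no copy of \<open>P\<^sub>3\<close> exists; and among the vertices of degree at least 2 there is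
  a vertex \<open>u\<close> with at most one neighbour in that set, so that all other neighbours of \<open>u\<close> are leaves.
  Let Minimizer choose \<open>u\<close>. By induction on the number of vertices, what is left after a good answer
  lies in \<open>\<D>\<close>, and in particular has no isolated vertex. Hence the answer takes all leaves at \<open>u\<close>.
  If it also took the inner neighbour \<open>p\<close> of \<open>u\<close>, there would be only one leaf at \<open>u\<close>, and by
  choosing \<open>p\<close> instead Minimizer would strand that leaf, alone or together with \<open>u\<close>. So the answer
  consists of \<open>u\<close> and its exactly two leaves. Finally \<open>p\<close>, if it exists, is a center in the rest:
  otherwise \<open>p\<close> has degree 2 in the forest, and choosing \<open>p\<close> forces \<open>u\<close> to be taken and its leaves
  to be stranded. Thus the star at \<open>u\<close> is attached to the rest by an edge between centers
  (\<open>perfect_imp_star_centers\<close>).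
\<close>

section \<open>Neighbours, induced subgraphs and copies of \<open>P\<^sub>3\<close>\<close>

definition nbrs :: "'a pair_pre_digraph \<Rightarrow> 'a \<Rightarrow> 'a set" where
  "nbrs G x = {y. (x, y) \<in> parcs G}"

lemma pair_graph_nbrs:
  assumes "pair_graph G"
  shows finite_pverts: "finite (pverts G)"
    and nbrs_sym: "y \<in> nbrs G x \<Longrightarrow> x \<in> nbrs G y"
    and nbrs_irrefl: "x \<notin> nbrs G x"
    and nbrs_pverts: "y \<in> nbrs G x \<Longrightarrow> x \<in> pverts G \<and> y \<in> pverts G"
proof -
  interpret pair_graph G by fact
  show "finite (pverts G)" by (rule pair_finite_verts)
  show "y \<in> nbrs G x \<Longrightarrow> x \<in> pverts G \<and> y \<in> pverts G"
    by (auto simp: nbrs_def dest: in_arcsD1 in_arcsD2)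
  show "y \<in> nbrs G x \<Longrightarrow> x \<in> nbrs G y"
    by (auto simp: nbrs_def intro: arcs_symmetric)
  show "x \<notin> nbrs G x"
    by (auto simp: nbrs_def dest: no_loops')
qed

lemma pverts_induced_pair [simp]: "pverts (induced_pair G U) = U"
  by (simp add: induced_pair_def)

lemma nbrs_induced_pair: "nbrs (induced_pair G U) x = (if x \<in> U then nbrs G x \<inter> U else {})"
  by (auto simp: induced_pair_def nbrs_def)

lemma pair_graph_induced_pair:
  assumes "pair_graph G" "U \<subseteq> pverts G"
  shows "pair_graph (induced_pair G U)"
proof -
  interpret pair_graph G by fact
  have "finite U"
    using assms(2) pair_finite_verts by (rule finite_subset)
  moreover have "parcs (induced_pair G U) \<subseteq> parcs G"
    by (auto simp: induced_pair_def)
  then have "finite (parcs (induced_pair G U))"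
    using pair_finite_arcs by (rule finite_subset)
  moreover have "symmetric (induced_pair G U)"
    using arcs_symmetric by (auto simp: symmetric_def induced_pair_def intro!: symI)
  ultimately show ?thesis
    by unfold_locales (auto simp: induced_pair_def dest: no_loops')
qed

lemma P3_copies_pair_graph:
  assumes "pair_graph G"
  shows "H \<in> P3_copies G v \<longleftrightarrow>
    (\<exists>a b. a \<noteq> b \<and> a \<in> nbrs G v \<and> b \<in> nbrs G v \<and>
      H = \<lparr>pverts = {a, v, b}, parcs = {(a, v), (v, a), (v, b), (b, v)}\<rparr>)"
    (is "_ \<longleftrightarrow> ?R")
proof
  assume "H \<in> P3_copies G v"
  then obtain a b where "distinct [a, v, b]"
    and H: "H = \<lparr>pverts = {a, v, b}, parcs = {(a, v), (v, a), (v, b), (b, v)}\<rparr>"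
    and "parcs H \<subseteq> parcs G"
    by (auto simp: P3_copies_def two_star_def subgraph_def)
  then show ?R by (auto simp: nbrs_def)
next
  interpret pair_graph G by fact
  assume ?R
  then obtain a b where ab: "a \<noteq> b" "a \<in> nbrs G v" "b \<in> nbrs G v"
    and H: "H = \<lparr>pverts = {a, v, b}, parcs = {(a, v), (v, a), (v, b), (b, v)}\<rparr>"
    by blast
  have "a \<noteq> v" "b \<noteq> v"
    using ab nbrs_irrefl[OF assms] by auto
  moreover have "wf_digraph (with_proj H)"
    by unfold_locales (auto simp: H)
  moreover have "wf_digraph (with_proj G)"
    by unfold_locales
  ultimately show "H \<in> P3_copies G v"
    using ab nbrs_sym[OF assms] nbrs_pverts[OF assms]
    by (auto simp: P3_copies_def two_star_def subgraph_def compatible_def H nbrs_def)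
qed

lemma P3_centers_pair_graph:
  assumes "pair_graph G"
  shows "P3_centers G = {v. \<exists>a b. a \<noteq> b \<and> a \<in> nbrs G v \<and> b \<in> nbrs G v}"
  unfolding P3_centers_def using P3_copies_pair_graph[OF assms] by blast

section \<open>Perfection as a recursive condition\<close>

lemma card_P3_copy: "H \<in> P3_copies G v \<Longrightarrow> card (pverts H) = 3"
  by (auto simp: P3_copies_def two_star_def)

lemma finite_P3_copies:
  assumes "finite (pverts G)"
  shows "finite (P3_copies G v)"
proof (rule finite_subset)
  show "P3_copies G v \<subseteq>
    (\<lambda>(a, b). \<lparr>pverts = {a, v, b}, parcs = {(a, v), (v, a), (v, b), (b, v)}\<rparr>) `
      (pverts G \<times> pverts G)"
    by (fastforce simp: P3_copies_def two_star_def subgraph_def image_iff)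
qed (use assms in simp)

lemma finite_P3_centers:
  assumes "finite (pverts G)"
  shows "finite (P3_centers G)"
proof (rule finite_subset)
  show "P3_centers G \<subseteq> pverts G"
    unfolding P3_centers_def using P3_copiesD by fast
qed (use assms in simp)

text \<open>
  No strategy of Minimizer is needed here: whichever legal center is chosen first, the answer to it
  costs three vertices, and the rest follows by induction.
\<close>

lemma star_game_value_le:
  assumes "finite (pverts G)"
  shows "3 * star_game_value Minimizer G \<le> card (pverts G)"
  using assms
proof (induction "card (pverts G)" arbitrary: G rule: less_induct)
  case less
  show ?case
  proof (cases "P3_centers G = {}")
    case True
    then show ?thesis by (simp add: star_game_value.simps)
  next
    case False
    then obtain v where v: "v \<in> P3_centers G" by blast
    let ?val = "\<lambda>H. star_game_value Minimizer (induced_pair G (pverts G - pverts H))"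
    let ?reply = "\<lambda>v. Max (?val ` P3_copies G v)"
    have "?reply v \<in> ?val ` P3_copies G v"
      using v finite_P3_copies[OF less.prems] by (intro Max_in) (auto simp: P3_centers_def)
    then obtain H where H: "H \<in> P3_copies G v" "?reply v = ?val H" by auto
    have "finite (pverts H)"
      using P3_copiesD(1)[OF H(1)] less.prems by (rule finite_subset)
    then have "card (pverts G - pverts H) = card (pverts G) - 3"
      and "card (pverts G) \<ge> 3"
      using card_Diff_subset P3_copiesD(1)[OF H(1)] card_P3_copy[OF H(1)]
        card_mono[OF less.prems P3_copiesD(1)[OF H(1)]] by metis+
    moreover from this have "3 * ?val H \<le> card (pverts G - pverts H)"
      using less.hyps[of "induced_pair G (pverts G - pverts H)"] less.prems by simp
    moreover have "Min (?reply ` P3_centers G) \<le> ?reply v"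
      using v finite_P3_centers[OF less.prems] by (intro Min_le) auto
    then have "star_game_value Minimizer G \<le> 1 + ?val H"
      using less.prems False H(2) by (subst star_game_value.simps) simp
    ultimately show ?thesis by linarith
  qed
qed

lemma star_perfect_iff_card: "star_perfect I G \<longleftrightarrow> 3 * star_game_value I G = card (pverts G)"
  unfolding star_perfect_def by linarith

text \<open>
  The minimum over the centers of the maximum over the answers reaches the upper bound of one third
  of the vertices exactly if each of these maxima reaches it, and a maximum of numbers below a
  common bound reaches that bound exactly if one of the numbers does.
\<close>

lemma star_perfect_Minimizer_iff:
  assumes fin: "finite (pverts G)"
  shows "star_perfect Minimizer G \<longleftrightarrow>
    (P3_centers G = {} \<longrightarrow> pverts G = {}) \<and>
    (\<forall>v \<in> P3_centers G. \<exists>H \<in> P3_copies G v.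
      star_perfect Minimizer (induced_pair G (pverts G - pverts H)))"
proof (cases "P3_centers G = {}")
  case True
  then show ?thesis
    using fin by (auto simp: star_perfect_iff_card star_game_value.simps)
next
  case False
  let ?val = "\<lambda>H. star_game_value Minimizer (induced_pair G (pverts G - pverts H))"
  let ?reply = "\<lambda>v. Max (?val ` P3_copies G v)"
  have rest: "card (pverts G) = card (pverts G - pverts H) + 3 \<and>
      3 * ?val H \<le> card (pverts G - pverts H)" if "H \<in> P3_copies G v" for H v
  proof
    have "finite (pverts H)"
      using P3_copiesD(1)[OF that] fin by (rule finite_subset)
    then show "card (pverts G) = card (pverts G - pverts H) + 3"
      using card_Diff_subset[of "pverts H" "pverts G"] P3_copiesD(1)[OF that]
        card_P3_copy[OF that] card_mono[OF fin P3_copiesD(1)[OF that]] by simp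
    show "3 * ?val H \<le> card (pverts G - pverts H)"
      using star_game_value_le[of "induced_pair G (pverts G - pverts H)"] fin by simp
  qed
  have reply_bound: "3 * (1 + ?reply v) \<le> card (pverts G)"
    and reply_eq: "3 * (1 + ?reply v) = card (pverts G) \<longleftrightarrow>
      (\<exists>H \<in> P3_copies G v. star_perfect Minimizer (induced_pair G (pverts G - pverts H)))"
    if v: "v \<in> P3_centers G" for v
  proof -
    have fin': "finite (?val ` P3_copies G v)"
      using finite_P3_copies[OF fin] by simp
    have "?reply v \<in> ?val ` P3_copies G v"
      using v fin' by (intro Max_in) (auto simp: P3_centers_def)
    then obtain H where H: "H \<in> P3_copies G v" "?reply v = ?val H" by auto
    show bound: "3 * (1 + ?reply v) \<le> card (pverts G)"
      using rest[OF H(1)] H(2) by simp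
    show "3 * (1 + ?reply v) = card (pverts G) \<longleftrightarrow>
      (\<exists>H \<in> P3_copies G v. star_perfect Minimizer (induced_pair G (pverts G - pverts H)))"
    proof
      assume "3 * (1 + ?reply v) = card (pverts G)"
      then have "3 * ?val H = card (pverts G - pverts H)"
        using rest[OF H(1)] H(2) by simp
      then show "\<exists>H \<in> P3_copies G v.
          star_perfect Minimizer (induced_pair G (pverts G - pverts H))"
        using H(1) by (auto simp: star_perfect_iff_card)
    next
      assume "\<exists>H \<in> P3_copies G v.
        star_perfect Minimizer (induced_pair G (pverts G - pverts H))"
      then obtain H' where H': "H' \<in> P3_copies G v"
        "3 * ?val H' = card (pverts G - pverts H')"
        by (auto simp: star_perfect_iff_card)
      have "?val H' \<le> ?reply v"
        using fin' H'(1) by (intro Max_ge) auto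
      then show "3 * (1 + ?reply v) = card (pverts G)"
        using bound rest[OF H'(1)] H'(2) by simp
    qed
  qed
  have fin'': "finite (?reply ` P3_centers G)" "?reply ` P3_centers G \<noteq> {}"
    using finite_P3_centers[OF fin] False by auto
  have game_value: "star_game_value Minimizer G = 1 + Min (?reply ` P3_centers G)"
    using fin False by (subst star_game_value.simps) simp
  have "star_perfect Minimizer G \<longleftrightarrow> (\<forall>v \<in> P3_centers G. 3 * (1 + ?reply v) = card (pverts G))"
  proof
    assume "star_perfect Minimizer G"
    then have perfect: "3 * (1 + Min (?reply ` P3_centers G)) = card (pverts G)"
      by (simp add: star_perfect_iff_card game_value)
    show "\<forall>v \<in> P3_centers G. 3 * (1 + ?reply v) = card (pverts G)"
    proof
      fix v assume v: "v \<in> P3_centers G"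
      then have "Min (?reply ` P3_centers G) \<le> ?reply v"
        using fin'' by (intro Min_le) auto
      then show "3 * (1 + ?reply v) = card (pverts G)"
        using reply_bound[OF v] perfect by simp
    qed
  next
    assume all: "\<forall>v \<in> P3_centers G. 3 * (1 + ?reply v) = card (pverts G)"
    have "Min (?reply ` P3_centers G) \<in> ?reply ` P3_centers G"
      using fin'' by (rule Min_in)
    then obtain v where "v \<in> P3_centers G" "Min (?reply ` P3_centers G) = ?reply v"
      by auto
    then show "star_perfect Minimizer G"
      using all by (simp add: star_perfect_iff_card game_value)
  qed
  then show ?thesis using reply_eq False by simp
qed

text \<open>
  The same recursion in terms of neighbourhoods, which frees the combinatorial arguments
  from graph-valued copies.
\<close>

lemma star_perfect_pair_graph_iff:
  assumes "pair_graph G"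
  shows "star_perfect Minimizer G \<longleftrightarrow>
    ((\<forall>v. \<forall>x \<in> nbrs G v. \<forall>y \<in> nbrs G v. x = y) \<longrightarrow> pverts G = {}) \<and>
    (\<forall>v x y. x \<in> nbrs G v \<longrightarrow> y \<in> nbrs G v \<longrightarrow> x \<noteq> y \<longrightarrow>
      (\<exists>a b. a \<in> nbrs G v \<and> b \<in> nbrs G v \<and> a \<noteq> b \<and>
        star_perfect Minimizer (induced_pair G (pverts G - {a, v, b}))))"
proof -
  have copies: "(\<exists>H \<in> P3_copies G v. P (pverts H)) \<longleftrightarrow>
    (\<exists>a b. a \<in> nbrs G v \<and> b \<in> nbrs G v \<and> a \<noteq> b \<and> P {a, v, b})" for P v
    unfolding Bex_def P3_copies_pair_graph[OF assms] by fastforce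
  show ?thesis
    unfolding star_perfect_Minimizer_iff[OF finite_pverts[OF assms]]
      copies[of _ "\<lambda>W. star_perfect Minimizer (induced_pair G (pverts G - W))"]
    unfolding P3_centers_pair_graph[OF assms] by blast
qed

section \<open>Forests are degenerate\<close>

text \<open>
  This is 1-degeneracy: every nonempty induced subgraph has a vertex of degree at most 1. For finite
  graphs it is equivalent to being a forest, but it passes to induced subgraphs trivially, and
  it provides directly the vertex with which Minimizer starts.
\<close>

definition degenerate :: "'a pair_pre_digraph \<Rightarrow> bool" where
  "degenerate G \<longleftrightarrow> (\<forall>U \<subseteq> pverts G. U \<noteq> {} \<longrightarrow>
     (\<exists>u \<in> U. \<forall>x \<in> nbrs G u \<inter> U. \<forall>y \<in> nbrs G u \<inter> U. x = y))"

lemma degenerate_induced_pair: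
  assumes "degenerate G" "U \<subseteq> pverts G"
  shows "degenerate (induced_pair G U)"
  unfolding degenerate_def
proof (intro allI impI)
  fix W assume W: "W \<subseteq> pverts (induced_pair G U)" "W \<noteq> {}"
  then obtain u where "u \<in> W" "\<forall>x \<in> nbrs G u \<inter> W. \<forall>y \<in> nbrs G u \<inter> W. x = y"
    using assms unfolding degenerate_def by (metis pverts_induced_pair subset_trans)
  then show "\<exists>u \<in> W. \<forall>x \<in> nbrs (induced_pair G U) u \<inter> W.
      \<forall>y \<in> nbrs (induced_pair G U) u \<inter> W. x = y"
    by (intro bexI[of _ u]) (auto simp: nbrs_induced_pair)
qed

text \<open>
  If every vertex of \<open>U\<close> had two neighbours in \<open>U\<close>, then the first vertex of a longest path in \<open>U\<close>
  would have, besides its successor, a second neighbour on the path, which closes a cycle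
  of length at least 3.
\<close>

lemma undirected_forest_degenerate:
  assumes forest: "undirected_forest G"
  shows "degenerate G"
  unfolding degenerate_def
proof (intro allI impI, rule ccontr)
  interpret pair_graph G using forest by (simp add: undirected_forest_def)
  note graph = pair_graph
  fix U assume U: "U \<subseteq> pverts G" "U \<noteq> {}"
    and "\<not> (\<exists>u \<in> U. \<forall>x \<in> nbrs G u \<inter> U. \<forall>y \<in> nbrs G u \<inter> U. x = y)"
  then have other: "\<exists>x \<in> nbrs G u \<inter> U. x \<noteq> w" if "u \<in> U" for u w
    using that by metis
  define path where
    "path n \<longleftrightarrow> (\<exists>u p v. apath u p v \<and> set (awalk_verts u p) \<subseteq> U \<and> length p = n)" for n
  obtain u0 where "u0 \<in> U" using U by blast
  then have "path 0"
    using U unfolding path_def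
    by (intro exI[of _ u0] exI[of _ "[]"]) (auto simp: apath_Nil_iff)
  moreover have "\<forall>n. path n \<longrightarrow> n \<le> card U"
  proof (intro allI impI)
    fix n assume "path n"
    then obtain u p v where p: "apath u p v" "set (awalk_verts u p) \<subseteq> U" "length p = n"
      unfolding path_def by blast
    have "Suc n = card (set (awalk_verts u p))"
      using p by (simp add: apath_def distinct_card length_awalk_verts)
    also have "\<dots> \<le> card U"
      using p(2) finite_subset[OF U(1) pair_finite_verts] by (rule card_mono[rotated])
    finally show "n \<le> card U" by simp
  qed
  ultimately obtain n where n: "path n" "\<And>m. path m \<Longrightarrow> m \<le> n"
    using ex_has_greatest_nat[of path 0 id "Suc (card U)"] by (auto simp: less_Suc_eq_le)
  then obtain u p v where p: "apath u p v" "set (awalk_verts u p) \<subseteq> U" "length p = n"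
    unfolding path_def by blast
  have u: "u \<in> U"
    using p hd_in_awalk_verts(2) by blast
  have closed: "x \<in> set (awalk_verts u p)" if x: "x \<in> nbrs G u" "x \<in> U" for x
  proof (rule ccontr)
    assume new: "x \<notin> set (awalk_verts u p)"
    have "(x, u) \<in> parcs G"
      using nbrs_sym[OF graph x(1)] by (simp add: nbrs_def)
    then have "apath x ((x, u) # p) v"
      using p(1) new by (simp add: apath_Cons_iff)
    moreover have "set (awalk_verts x ((x, u) # p)) \<subseteq> U"
      using p x by simp
    ultimately have "path (Suc n)"
      unfolding path_def using p(3) by (metis length_Cons)
    then show False using n(2) by fastforce
  qed
  show False
  proof (cases p)
    case Nil
    then show False
      using other[OF u, of u] closed by auto
  next
    case (Cons e q)
    then obtain w where e: "e = (u, w)" and q: "apath w q v" "u \<notin> set (awalk_verts w q)"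
      and uw: "(u, w) \<in> parcs G"
      using p(1) by (cases e) (auto simp: apath_Cons_iff)
    obtain x where x: "x \<in> nbrs G u" "x \<in> U" "x \<noteq> w"
      using other[OF u] by blast
    have "x \<noteq> u" using x(1) nbrs_irrefl[OF graph] by blast
    then have "x \<in> set (awalk_verts w q)"
      using closed[OF x(1,2)] Cons e by simp
    then obtain q1 q2 where q12: "q = q1 @ q2" "awalk w q1 x"
      using q(1) awalk_decomp[of w q v x] unfolding apath_def by blast
    have "q1 \<noteq> []" using q12(2) x(3) by (auto simp: awalk_Nil_iff)
    have "distinct (awalk_verts w q1)" "u \<notin> set (awalk_verts w q1)"
      using q q12 by (auto simp: apath_def awalk_verts_append)
    moreover have "(x, u) \<in> parcs G"
      using nbrs_sym[OF graph x(1)] by (simp add: nbrs_def)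
    ultimately have "cycle ((x, u) # (u, w) # q1)"
      unfolding cycle_def using q12(2) uw
      by (intro exI[of _ x]) (auto simp: awalk_Cons_iff)
    moreover have "length ((x, u) # (u, w) # q1) \<ge> 3"
      using \<open>q1 \<noteq> []\<close> by (cases q1) auto
    ultimately show False
      using forest unfolding undirected_forest_def by blast
  qed
qed

section \<open>A local description of the star decomposition\<close>

text \<open>
  A decomposition in the sense of \<open>\<D>\<close> is determined by its set of centers: the other vertices
  are leaves, each star consists of a center and its two neighbours outside \<open>C\<close>, and the added edges
  are the edges inside \<open>C\<close>.
\<close>

definition star_centers :: "'a pair_pre_digraph \<Rightarrow> 'a set \<Rightarrow> bool" where
  "star_centers G C \<longleftrightarrow> C \<subseteq> pverts G \<and>
     (\<forall>x \<in> pverts G - C. \<exists>c \<in> C. nbrs G x = {c}) \<and>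
     (\<forall>c \<in> C. \<exists>a b. a \<noteq> b \<and> nbrs G c - C = {a, b})"

lemma star_forests_iff_star_centers:
  "G \<in> star_forests \<longleftrightarrow> undirected_forest G \<and> (\<exists>C. star_centers G C)"
proof
  assume "G \<in> star_forests"
  then obtain S F where forest: "undirected_forest G"
    and stars: "\<forall>(c, H) \<in> S. two_star c H"
    and disj: "disjoint_family_on (\<lambda>(c, H). pverts H) S"
    and F: "F \<subseteq> fst ` S \<times> fst ` S"
    and V: "pverts G = (\<Union>(c, H) \<in> S. pverts H)"
    and A: "parcs G = (\<Union>(c, H) \<in> S. parcs H) \<union> F"
    unfolding star_forests_def mem_Collect_eq by (elim conjE exE) (rule that)
  have two_star: "two_star c H" if "(c, H) \<in> S" for c H
    using stars that by blast
  define C where "C = fst ` S"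
  have unique: "c = d \<and> H = K" if "(c, H) \<in> S" "(d, K) \<in> S" "x \<in> pverts H" "x \<in> pverts K" for c d H K x
    using disj that unfolding disjoint_family_on_def by fastforce
  have centers: "x = c" if "(c, H) \<in> S" "x \<in> pverts H" "x \<in> C" for c H x
  proof -
    obtain K where K: "(x, K) \<in> S" using \<open>x \<in> C\<close> unfolding C_def by force
    then have "x \<in> pverts K" using two_star[OF K] by (auto simp: two_star_def)
    then show "x = c" using unique[OF K that(1)] that(2) by blast
  qed
  have shape: "\<exists>a b. a \<noteq> b \<and> pverts H = {a, c, b} \<and> nbrs G c - C = {a, b} \<and> nbrs G a = {c} \<and> nbrs G b = {c}"
    if cH: "(c, H) \<in> S" for c H
  proof -
    obtain a b where ab: "distinct [a, c, b]"
      and H: "H = \<lparr>pverts = {a, c, b}, parcs = {(a, c), (c, a), (c, b), (b, c)}\<rparr>"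
      using two_star[OF cH] unfolding two_star_def by blast
    have notC: "a \<notin> C" "b \<notin> C" using centers[OF cH] ab by (auto simp: H)
    have "c \<in> C" using cH unfolding C_def by force
    have arc: "(x, y) \<in> parcs G \<longleftrightarrow> (x, y) \<in> parcs H \<or> (x, y) \<in> F" if "x \<in> pverts H" for x y
    proof
      assume "(x, y) \<in> parcs G"
      then consider "(x, y) \<in> F" | d K where "(d, K) \<in> S" "(x, y) \<in> parcs K"
        unfolding A by blast
      then show "(x, y) \<in> parcs H \<or> (x, y) \<in> F"
      proof cases
        case 2
        then have "x \<in> pverts K" using two_star[OF 2(1)] by (auto simp: two_star_def)
        then show ?thesis using unique[OF cH 2(1) that] 2 by blast
      qed simp
    qed (use cH A in blast)
    have "nbrs G a = {c}" "nbrs G b = {c}"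
      using F notC ab unfolding nbrs_def by (auto simp: arc H C_def)
    moreover have "nbrs G c - C = {a, b}"
      using F notC ab unfolding nbrs_def by (auto simp: arc H C_def)
    ultimately show ?thesis using ab by (auto simp: H)
  qed
  have "star_centers G C"
    unfolding star_centers_def
  proof (intro conjI ballI)
    show "C \<subseteq> pverts G"
      using two_star unfolding V C_def two_star_def by fastforce
    fix x assume "x \<in> pverts G - C"
    then obtain c H where cH: "(c, H) \<in> S" "x \<in> pverts H" "x \<notin> C" unfolding V by blast
    moreover have "c \<in> C" using cH(1) unfolding C_def by force
    ultimately show "\<exists>c \<in> C. nbrs G x = {c}" using shape[OF cH(1)] by auto
  next
    fix c assume "c \<in> C"
    then obtain H where "(c, H) \<in> S" unfolding C_def by force
    then show "\<exists>a b. a \<noteq> b \<and> nbrs G c - C = {a, b}" using shape by blast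
  qed
  with forest show "undirected_forest G \<and> (\<exists>C. star_centers G C)" by blast
next
  assume "undirected_forest G \<and> (\<exists>C. star_centers G C)"
  then obtain C where forest: "undirected_forest G" and centers: "star_centers G C"
    by blast
  then have C: "C \<subseteq> pverts G"
    and leaf: "\<And>x. x \<in> pverts G \<Longrightarrow> x \<notin> C \<Longrightarrow> \<exists>c \<in> C. nbrs G x = {c}"
    and center: "\<And>c. c \<in> C \<Longrightarrow> \<exists>a b. a \<noteq> b \<and> nbrs G c - C = {a, b}"
    unfolding star_centers_def by blast+
  have graph: "pair_graph G" using forest by (simp add: undirected_forest_def)
  define L where "L c = nbrs G c - C" for c
  define star where "star c = \<lparr>pverts = insert c (L c), parcs = {c} \<times> L c \<union> L c \<times> {c}\<rparr>" for c
  define S where "S = (\<lambda>c. (c, star c)) ` C"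
  define F where "F = parcs G \<inter> C \<times> C"
  have L: "nbrs G x = {c}" if "x \<in> L c" for x c
  proof -
    have "x \<in> pverts G" "x \<notin> C" "c \<in> nbrs G x"
      using that nbrs_pverts[OF graph] nbrs_sym[OF graph] unfolding L_def by blast+
    then show ?thesis using leaf[of x] by auto
  qed
  have leaf_star: "\<exists>c \<in> C. x \<in> L c \<and> nbrs G x = {c}" if x: "x \<in> pverts G" "x \<notin> C" for x
  proof -
    obtain c where c: "c \<in> C" "nbrs G x = {c}" using leaf[OF x] by auto
    then have "x \<in> nbrs G c" using nbrs_sym[OF graph, of c x] by simp
    then show ?thesis using c x(2) unfolding L_def by auto
  qed
  have "finite S"
    unfolding S_def using finite_subset[OF C finite_pverts[OF graph]] by simp
  moreover have "\<forall>(c, H) \<in> S. two_star c H"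
  proof -
    have "two_star c (star c)" if c: "c \<in> C" for c
    proof -
      obtain a b where ab: "a \<noteq> b" "L c = {a, b}" using center[OF c] unfolding L_def by blast
      then have "a \<in> L c" "b \<in> L c" by simp_all
      then have "c \<noteq> a" "c \<noteq> b" using c by (auto simp: L_def)
      then have "distinct [a, c, b]" using ab(1) by auto
      moreover have "star c =
          \<lparr>pverts = {a, c, b}, parcs = {(a, c), (c, a), (c, b), (b, c)}\<rparr>"
        unfolding star_def ab(2) by auto
      ultimately show ?thesis unfolding two_star_def by blast
    qed
    then show ?thesis unfolding S_def by blast
  qed
  moreover have "disjoint_family_on (\<lambda>(c, H). pverts H) S"
  proof -
    have "pverts (star c) \<inter> pverts (star d) = {}" if "c \<in> C" "d \<in> C" "c \<noteq> d" for c d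
    proof -
      have "L c \<inter> C = {}" "L d \<inter> C = {}" unfolding L_def by auto
      moreover have "L c \<inter> L d = {}"
      proof (rule ccontr)
        assume "L c \<inter> L d \<noteq> {}"
        then obtain x where "x \<in> L c" "x \<in> L d" by auto
        then have "{c} = {d}" using L by metis
        then show False using that(3) by simp
      qed
      ultimately show ?thesis using that by (auto simp: star_def)
    qed
    then show ?thesis unfolding disjoint_family_on_def S_def by auto
  qed
  moreover have "F \<subseteq> fst ` S \<times> fst ` S"
    unfolding F_def S_def by (auto simp: image_image)
  moreover have "pverts G = (\<Union>(c, H) \<in> S. pverts H)"
  proof -
    have "pverts G = (\<Union>c \<in> C. pverts (star c))"
    proof
      show "pverts G \<subseteq> (\<Union>c \<in> C. pverts (star c))"
      proof
        fix x assume x: "x \<in> pverts G"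
        show "x \<in> (\<Union>c \<in> C. pverts (star c))"
          using leaf_star[OF x] by (cases "x \<in> C") (auto simp: star_def)
      qed
      have "nbrs G c \<subseteq> pverts G" for c using nbrs_pverts[OF graph] by blast
      then show "(\<Union>c \<in> C. pverts (star c)) \<subseteq> pverts G"
        using C by (auto simp: star_def L_def)
    qed
    then show ?thesis unfolding S_def by simp
  qed
  moreover have "parcs G = (\<Union>(c, H) \<in> S. parcs H) \<union> F"
  proof -
    have "(x, y) \<in> parcs G \<longleftrightarrow> (\<exists>c \<in> C. (x, y) \<in> parcs (star c)) \<or> (x, y) \<in> F" for x y
    proof
      assume xy: "(x, y) \<in> parcs G"
      then have y: "y \<in> nbrs G x" by (simp add: nbrs_def)
      note x = nbrs_sym[OF graph y]
      have V: "x \<in> pverts G" "y \<in> pverts G" using nbrs_pverts[OF graph y] by auto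
      consider "x \<in> C" "y \<in> C" | "x \<notin> C" | "y \<notin> C" by blast
      then show "(\<exists>c \<in> C. (x, y) \<in> parcs (star c)) \<or> (x, y) \<in> F"
      proof cases
        case 1
        then show ?thesis using xy by (simp add: F_def)
      next
        case 2
        then obtain c where "c \<in> C" "x \<in> L c" "nbrs G x = {c}" using leaf_star[OF V(1)] by auto
        then show ?thesis using y by (auto simp: star_def)
      next
        case 3
        then obtain c where "c \<in> C" "y \<in> L c" "nbrs G y = {c}" using leaf_star[OF V(2)] by auto
        then show ?thesis using x by (auto simp: star_def)
      qed
    next
      assume "(\<exists>c \<in> C. (x, y) \<in> parcs (star c)) \<or> (x, y) \<in> F"
      then consider "(x, y) \<in> F" | "y \<in> nbrs G x" | "x \<in> nbrs G y"
        by (auto simp: star_def L_def)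
      then show "(x, y) \<in> parcs G"
        using nbrs_sym[OF graph, of x y] by cases (auto simp: F_def nbrs_def)
    qed
    then show ?thesis unfolding S_def by auto
  qed
  ultimately show "G \<in> star_forests"
    unfolding star_forests_def using forest by blast
qed

section \<open>Star decompositions give perfection\<close>

text \<open>
  Both leaves of a star see only its center, so removing the star does not affect
  the leaves of the other stars.
\<close>

lemma star_centers_remove:
  assumes graph: "pair_graph G" and "star_centers G C" and c: "c \<in> C"
    and ab: "nbrs G c - C = {a, b}"
  shows "star_centers (induced_pair G (pverts G - {a, c, b})) (C - {c})"
proof -
  have C: "C \<subseteq> pverts G"
    and leaf: "\<And>x. x \<in> pverts G \<Longrightarrow> x \<notin> C \<Longrightarrow> \<exists>c \<in> C. nbrs G x = {c}"
    and center: "\<And>c. c \<in> C \<Longrightarrow> \<exists>a b. a \<noteq> b \<and> nbrs G c - C = {a, b}"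
    using assms(2) unfolding star_centers_def by blast+
  let ?U = "pverts G - {a, c, b}"
  have "a \<notin> C" "b \<notin> C" using ab by blast+
  then have CU: "C - {c} \<subseteq> ?U" using C by blast
  have own: "d = c" if "d \<in> nbrs G x" "x = a \<or> x = b" for x d
  proof -
    have x: "x \<in> nbrs G c" "x \<notin> C" using ab that(2) by blast+
    then show ?thesis
      using leaf[of x] nbrs_sym[OF graph x(1)] nbrs_pverts[OF graph x(1)] that(1) by auto
  qed
  show ?thesis
    unfolding star_centers_def pverts_induced_pair
  proof (intro conjI ballI)
    show "C - {c} \<subseteq> ?U" by (rule CU)
  next
    fix x assume x: "x \<in> ?U - (C - {c})"
    then obtain d where d: "d \<in> C" "nbrs G x = {d}" using leaf[of x] by blast
    then have "x \<in> nbrs G d" using nbrs_sym[OF graph, of d x] by blast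
    then have "d \<noteq> c" using x ab by blast
    then show "\<exists>d \<in> C - {c}. nbrs (induced_pair G ?U) x = {d}"
      using d CU x by (auto simp: nbrs_induced_pair)
  next
    fix d assume d: "d \<in> C - {c}"
    then obtain a' b' where ab': "a' \<noteq> b'" "nbrs G d - C = {a', b'}" using center[of d] by blast
    have "nbrs G d \<subseteq> pverts G" using nbrs_pverts[OF graph] by blast
    moreover have "a \<notin> nbrs G d" "b \<notin> nbrs G d"
      using own nbrs_sym[OF graph] d by blast+
    ultimately have "nbrs (induced_pair G ?U) d - (C - {c}) = nbrs G d - C"
      using d CU c by (auto simp: nbrs_induced_pair)
    then show "\<exists>a b. a \<noteq> b \<and> nbrs (induced_pair G ?U) d - (C - {c}) = {a, b}"
      using ab' by auto
  qed
qed

text \<open>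
  A legal center has degree at least 2, hence belongs to \<open>C\<close>, and Maximizer answers with its star.
\<close>

lemma star_centers_imp_perfect:
  assumes "pair_graph G" "star_centers G C"
  shows "star_perfect Minimizer G"
  using assms
proof (induction "card (pverts G)" arbitrary: G C rule: less_induct)
  case less
  note graph = less.prems(1)
  have C: "C \<subseteq> pverts G"
    and leaf: "\<And>x. x \<in> pverts G \<Longrightarrow> x \<notin> C \<Longrightarrow> \<exists>c \<in> C. nbrs G x = {c}"
    and center: "\<And>c. c \<in> C \<Longrightarrow> \<exists>a b. a \<noteq> b \<and> nbrs G c - C = {a, b}"
    using less.prems(2) unfolding star_centers_def by blast+
  show ?case
    unfolding star_perfect_pair_graph_iff[OF graph]
  proof (intro conjI impI allI)
    assume small: "\<forall>v. \<forall>x \<in> nbrs G v. \<forall>y \<in> nbrs G v. x = y"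
    have "C = {}" using center small by (metis Diff_iff insertI1 insertI2 ex_in_conv)
    then show "pverts G = {}" using leaf by blast
  next
    fix v x y assume xy: "x \<in> nbrs G v" "y \<in> nbrs G v" "x \<noteq> y"
    then have v: "v \<in> C"
      using leaf[of v] nbrs_pverts[OF graph xy(1)] by (metis singletonD)
    then obtain a b where ab: "a \<noteq> b" "nbrs G v - C = {a, b}" using center by blast
    have "star_perfect Minimizer (induced_pair G (pverts G - {a, v, b}))"
    proof (rule less.hyps)
      have "pverts G - {a, v, b} \<subset> pverts G" using v C by blast
      then show "card (pverts (induced_pair G (pverts G - {a, v, b}))) < card (pverts G)"
        using finite_pverts[OF graph] by (simp add: psubset_card_mono)
      show "pair_graph (induced_pair G (pverts G - {a, v, b}))"
        using graph by (rule pair_graph_induced_pair) blast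
      show "star_centers (induced_pair G (pverts G - {a, v, b})) (C - {v})"
        using graph less.prems(2) v ab(2) by (rule star_centers_remove)
    qed
    then show "\<exists>a b. a \<in> nbrs G v \<and> b \<in> nbrs G v \<and> a \<noteq> b \<and>
        star_perfect Minimizer (induced_pair G (pverts G - {a, v, b}))"
      using ab by blast
  qed
qed

section \<open>Perfect forests have a star decomposition\<close>

text \<open>
  The next two lemmas are the obstructions by which Minimizer's threats are recognised:
  a remaining graph with a stranded vertex or a stranded edge has no star decomposition.
\<close>

lemma star_centers_no_isolated:
  assumes "star_centers G C" "x \<in> pverts G"
  shows "nbrs G x \<noteq> {}"
  using assms unfolding star_centers_def by blast

lemma star_centers_no_isolated_edge:
  assumes "star_centers G C" "x \<in> pverts G" "y \<in> pverts G"
  shows "\<not> (nbrs G x = {y} \<and> nbrs G y = {x})"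
proof
  assume xy: "nbrs G x = {y} \<and> nbrs G y = {x}"
  have two: "z \<notin> C" if "nbrs G z = {w}" for z w
    using assms(1) that unfolding star_centers_def by (metis Diff_subset insert_subset singletonD)
  then have "x \<notin> C" "y \<notin> C" using xy by blast+
  then show False using assms xy unfolding star_centers_def by (metis DiffI singleton_inject)
qed

text \<open>
  This reverses \<open>star_centers_remove\<close>: a new star may be attached by edges from its center \<open>u\<close>
  to old centers, which form the set \<open>P\<close>.
\<close>

lemma star_centers_add:
  assumes graph: "pair_graph G"
    and ab: "nbrs G u = {a, b} \<union> P" "a \<noteq> b" "nbrs G a = {u}" "nbrs G b = {u}"
    and P: "P \<subseteq> C"
    and C: "star_centers (induced_pair G (pverts G - {a, u, b})) C"
  shows "star_centers G (insert u C)"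
proof -
  let ?U = "pverts G - {a, u, b}"
  have u: "u \<in> pverts G" "a \<noteq> u" "b \<noteq> u"
    using ab nbrs_pverts[OF graph, of a u] nbrs_irrefl[OF graph, of u] by auto
  have CU: "C \<subseteq> ?U"
    using C unfolding star_centers_def by simp
  have leaf: "\<exists>c \<in> C. nbrs G x \<inter> ?U = {c}" if "x \<in> ?U" "x \<notin> C" for x
    using C that unfolding star_centers_def by (simp add: nbrs_induced_pair)
  have center: "\<exists>a b. a \<noteq> b \<and> nbrs G c \<inter> ?U - C = {a, b}" if "c \<in> C" for c
  proof -
    have "c \<in> ?U" using CU that by blast
    moreover have "\<exists>a b. a \<noteq> b \<and> nbrs (induced_pair G ?U) c - C = {a, b}"
      using C that unfolding star_centers_def by blast
    ultimately show ?thesis by (simp add: nbrs_induced_pair)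
  qed
  have only_u: "a \<notin> nbrs G x" "b \<notin> nbrs G x" if "x \<noteq> u" for x
    using that ab nbrs_sym[OF graph] by blast+
  have old_leaf: "nbrs G x = nbrs G x \<inter> ?U" if "x \<in> ?U" "x \<notin> C" for x
  proof -
    have "u \<notin> nbrs G x" using that ab(1) P nbrs_sym[OF graph, of u x] by blast
    then show ?thesis using only_u[of x] that nbrs_pverts[OF graph] by blast
  qed
  have old_center: "nbrs G c - insert u C = nbrs G c \<inter> ?U - C" if "c \<in> C" for c
    using only_u[of c] that CU nbrs_pverts[OF graph] by blast
  have new_center: "nbrs G u - insert u C = {a, b}"
    using ab(1) P CU u nbrs_irrefl[OF graph] by blast
  show ?thesis
    unfolding star_centers_def
  proof (intro conjI ballI)
    show "insert u C \<subseteq> pverts G" using CU u by blast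
  next
    fix x assume "x \<in> pverts G - insert u C"
    then consider "x = a" | "x = b" | "x \<in> ?U" "x \<notin> C" by blast
    then show "\<exists>c \<in> insert u C. nbrs G x = {c}"
    proof cases
      case 3
      then show ?thesis using leaf[OF 3] old_leaf[OF 3] by auto
    qed (use ab in auto)
  next
    fix c assume "c \<in> insert u C"
    then consider "c = u" | "c \<in> C" by blast
    then show "\<exists>a b. a \<noteq> b \<and> nbrs G c - insert u C = {a, b}"
    proof cases
      case 1
      then show ?thesis using ab(2) new_center by blast
    next
      case 2
      then show ?thesis using center[OF 2] old_center[OF 2] by simp
    qed
  qed
qed

text \<open>
  The induction needs only that the rest after Maximizer's answer is perfect, for which it yields
  a decomposition. It is applied to two kinds of rests: to the one left after Minimizer's real move \<open>u\<close>,
  whose decomposition is extended by the star at \<open>u\<close>, and to those left after threats, where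
  a decomposition is shown to be impossible.
\<close>

lemma perfect_imp_star_centers:
  assumes "pair_graph G" "degenerate G" "star_perfect Minimizer G"
  shows "\<exists>C. star_centers G C"
  using assms
proof (induction "card (pverts G)" arbitrary: G rule: less_induct)
  case less
  note graph = less.prems(1)
  let ?rest = "\<lambda>v a b. induced_pair G (pverts G - {a, v, b})"
  have move: "\<exists>a b C. a \<in> nbrs G v \<and> b \<in> nbrs G v \<and> a \<noteq> b \<and> star_centers (?rest v a b) C"
    if xy: "x \<in> nbrs G v" "y \<in> nbrs G v" "x \<noteq> y" for v x y
  proof -
    obtain a b where ab: "a \<in> nbrs G v" "b \<in> nbrs G v" "a \<noteq> b"
      and perfect: "star_perfect Minimizer (?rest v a b)"
      using less.prems(3) xy unfolding star_perfect_pair_graph_iff[OF graph] by blast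
    have "v \<in> pverts G" using nbrs_pverts[OF graph xy(1)] by blast
    then have "pverts G - {a, v, b} \<subset> pverts G" by blast
    then have "card (pverts (?rest v a b)) < card (pverts G)"
      using finite_pverts[OF graph] by (simp add: psubset_card_mono)
    then have "\<exists>C. star_centers (?rest v a b) C"
      using perfect less.prems(1,2)
      by (intro less.hyps) (auto intro: pair_graph_induced_pair degenerate_induced_pair)
    then show ?thesis using ab by blast
  qed
  have stranded: False
    if "star_centers (?rest v a b) C" "x \<in> pverts G - {a, v, b}" "nbrs G x \<subseteq> {a, v, b}" for v a b C x
    using star_centers_no_isolated[OF that(1), of x] that(2,3) by (auto simp: nbrs_induced_pair)
  \<comment> \<open>The inner vertices, that is, those of degree at least 2.\<close>
  define I where "I = {v. \<exists>x \<in> nbrs G v. \<exists>y \<in> nbrs G v. x \<noteq> y}"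
  show ?case
  proof (cases "I = {}")
    case True
    then have "pverts G = {}"
      using less.prems(3) unfolding star_perfect_pair_graph_iff[OF graph] I_def by blast
    then have "star_centers G {}" by (simp add: star_centers_def)
    then show ?thesis ..
  next
    case False
    have "I \<subseteq> pverts G" unfolding I_def using nbrs_pverts[OF graph] by blast
    then obtain u where u: "u \<in> I"
      and "\<forall>x \<in> nbrs G u \<inter> I. \<forall>y \<in> nbrs G u \<inter> I. x = y"
      using less.prems(2) False unfolding degenerate_def by meson
    then have inner: "x = y" if "x \<in> nbrs G u" "x \<in> I" "y \<in> nbrs G u" "y \<in> I" for x y
      using that by (metis IntI)
    have leaf: "nbrs G x = {u}" if "x \<in> nbrs G u" "x \<notin> I" for x
      using that nbrs_sym[OF graph, of x u] unfolding I_def by blast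
    obtain a b C where ab: "a \<in> nbrs G u" "b \<in> nbrs G u" "a \<noteq> b"
      and C: "star_centers (?rest u a b) C"
      using u move unfolding I_def by blast
    have au: "a \<noteq> u" "b \<noteq> u" using ab nbrs_irrefl[OF graph] by blast+
    have leaves: "x = a \<or> x = b" if "x \<in> nbrs G u" "x \<notin> I" for x
      using stranded[OF C, of x] leaf[OF that] that nbrs_pverts[OF graph] nbrs_irrefl[OF graph] by blast
    \<comment> \<open>If \<open>u\<close> has just one leaf \<open>l\<close>, Minimizer chooses the other neighbour \<open>p\<close>: an answer that takes \<open>u\<close>
      isolates \<open>l\<close>, and any other answer leaves \<open>u\<close> and \<open>l\<close> as an isolated edge.\<close>
    have no_inner: False if p: "p \<in> nbrs G u" "p \<in> I" "nbrs G u = {l, p}" "l \<noteq> p" "l \<notin> I" for p l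
    proof -
      obtain x y D where xy: "x \<in> nbrs G p" "y \<in> nbrs G p" "x \<noteq> y"
        and D: "star_centers (?rest p x y) D"
        using p(2) move unfolding I_def by blast
      have l: "nbrs G l = {u}" using leaf p by blast
      have lV: "l \<in> pverts G" "u \<in> pverts G" using nbrs_pverts[OF graph, of l u] p(3) by auto
      have up: "u \<noteq> p" "u \<noteq> l" using p(3) nbrs_irrefl[OF graph, of u] by auto
      have "l \<notin> nbrs G p" using l up(1) nbrs_sym[OF graph, of l p] by auto
      then have lxy: "l \<noteq> x" "l \<noteq> y" using xy by auto
      show False
      proof (cases "u = x \<or> u = y")
        case True
        then show False using stranded[OF D, of l] l lV lxy p(4) by auto
      next
        case False
        then show False
          using star_centers_no_isolated_edge[OF D, of u l] l lV lxy p(3,4) up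
          by (auto simp: nbrs_induced_pair)
      qed
    qed
    \<comment> \<open>An answer containing the inner neighbour of \<open>u\<close> contains all neighbours of \<open>u\<close>,
      since it also contains all leaves at \<open>u\<close>.\<close>
    have two: "nbrs G u = {a, b}" if "a \<in> I \<or> b \<in> I"
    proof
      show "nbrs G u \<subseteq> {a, b}"
      proof
        fix x assume x: "x \<in> nbrs G u"
        show "x \<in> {a, b}"
        proof (cases "x \<in> I")
          case True
          then show ?thesis using that inner[OF x True ab(1)] inner[OF x True ab(2)] by auto
        next
          case False
          then show ?thesis using leaves[OF x] by simp
        qed
      qed
    qed (use ab in simp)
    have aI: "a \<notin> I"
    proof
      assume a: "a \<in> I"
      then have "b \<notin> I" using inner[OF ab(1) a ab(2)] ab(3) by auto
      then show False using no_inner[OF ab(1) a, of b] two a ab(3) by auto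
    qed
    have bI: "b \<notin> I"
      using no_inner[OF ab(2), of a] two ab(3) aI by auto
    have "nbrs G u - {a, b} \<subseteq> C"
    proof
      fix p assume p: "p \<in> nbrs G u - {a, b}"
      have nu: "u \<in> nbrs G p" using p nbrs_sym[OF graph, of p u] by simp
      have pU: "p \<in> pverts G - {a, u, b}"
        using p nbrs_pverts[OF graph, of p u] nbrs_irrefl[OF graph, of u] by auto
      \<comment> \<open>Otherwise \<open>p\<close> is a leaf of a star of the rest with some center \<open>c\<close>, so that \<open>u - p - c\<close> is the only
        copy centered at \<open>p\<close>, and taking it isolates \<open>a\<close>.\<close>
      show "p \<in> C"
      proof (rule ccontr)
        assume "p \<notin> C"
        then obtain c where "nbrs (?rest u a b) p = {c}"
          using C pU unfolding star_centers_def pverts_induced_pair by blast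
        then have c: "nbrs G p \<inter> (pverts G - {a, u, b}) = {c}"
          using pU by (simp add: nbrs_induced_pair)
        have "p \<noteq> u" using pU by simp
        then have "a \<notin> nbrs G p" "b \<notin> nbrs G p"
          using leaf[OF ab(1) aI] leaf[OF ab(2) bI]
            nbrs_sym[OF graph, of a p] nbrs_sym[OF graph, of b p] by auto
        moreover have "nbrs G p \<subseteq> pverts G" using nbrs_pverts[OF graph] by blast
        ultimately have np: "nbrs G p = {u, c}" using nu c by auto
        have cu: "c \<noteq> u" "c \<noteq> a" using c by auto
        obtain x y D where xy: "x \<in> nbrs G p" "y \<in> nbrs G p" "x \<noteq> y"
          and D: "star_centers (?rest p x y) D"
          using move[of u p c] np cu by auto
        have "{x, p, y} = {u, p, c}" using np xy by auto
        moreover have "a \<in> pverts G" using nbrs_pverts[OF graph ab(1)] by simp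
        moreover have "a \<noteq> p" using p by auto
        ultimately show False
          using stranded[OF D, of a] leaf[OF ab(1) aI] cu au by auto
      qed
    qed
    then have "star_centers G (insert u C)"
      using ab leaf[OF ab(1) aI] leaf[OF ab(2) bI] C
      by (intro star_centers_add[OF graph, of u a b "nbrs G u - {a, b}"]) auto
    then show ?thesis ..
  qed
qed

theorem lemma8:
  fixes T :: "'a pair_pre_digraph"
  assumes "undirected_tree T"
  shows "star_perfect Minimizer T \<longleftrightarrow> T \<in> star_forests"
proof -
  have forest: "undirected_forest T" using assms by (simp add: undirected_tree_def)
  then have graph: "pair_graph T" by (simp add: undirected_forest_def)
  show ?thesis
    using perfect_imp_star_centers[OF graph undirected_forest_degenerate[OF forest]]
      star_centers_imp_perfect[OF graph] forest
    unfolding star_forests_iff_star_centers by blast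
qed

end
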